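(* For every computable function $f:\mathbb{N}\to\mathbb{N}$ there is a constant $c$ (depending on $f$) such that for every $m$ there is a computable infinite binary sequence $\alpha$ with $C^{0'}(\alpha)\leqslant m+c$ and $M_{\infty}(\alpha)\geqslant f(m)$.
   Context: Fix an optimal programming language $U$ (a computable $(p,n)\mapsto U(p,n)$ such that every computable $V(p,n)$ is simulated with at most constant increase of program length); write $p(n)=U(p,n)$, $l(p)$ for the length of $p$, and $C(x|n)=\min\{l(p)\mid p(n)=x\}$. $\alpha_{1:n}$ is the length-$n$ prefix of $\alpha$. $M_{\infty}(\alpha)=\limsup_n C(\alpha_{1:n}|n)$. For an oracle $A$, $C^A(\alpha)$ is the minimal length of a program $p$ in an optimal programming language with oracle $A$ such that $p^A(n)=\alpha_{1:n}$ for all $n$. $0'$ denotes the halting problem. *)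

theory Defs
  imports Main "HOL-Library.Nat_Bijection" "HOL-Library.Extended_Nat" "HOL-Library.Liminf_Limsup"
begin

text \<open>
  Partial recursive functions relative to a set \<open>A\<close> of natural numbers. All functions are unary;
  several arguments are packed with the Cantor pairing \<^const>\<open>prod_encode\<close>.
\<close>

datatype recfun =
    Zero
  | Succ
  | Fst
  | Snd
  | Query
  | Pairing recfun recfun
  | Comp recfun recfun
  | PrimRec recfun recfun
  | Mu recfun

primrec eval :: "nat set \<Rightarrow> recfun \<Rightarrow> nat \<Rightarrow> nat option" where
  "eval A Zero = (\<lambda>x. Some 0)"
| "eval A Succ = (\<lambda>x. Some (Suc x))"
| "eval A Fst = (\<lambda>x. Some (fst (prod_decode x)))"
| "eval A Snd = (\<lambda>x. Some (snd (prod_decode x)))"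
| "eval A Query = (\<lambda>x. Some (if x \<in> A then 1 else 0))"
| "eval A (Pairing f g) = (\<lambda>x.
     Option.bind (eval A f x) (\<lambda>y. Option.bind (eval A g x) (\<lambda>z. Some (prod_encode (y, z)))))"
| "eval A (Comp f g) = (\<lambda>x. Option.bind (eval A g x) (eval A f))"
| "eval A (PrimRec f g) = (\<lambda>x. case prod_decode x of (a, n) \<Rightarrow>
     rec_nat (eval A f a)
       (\<lambda>k r. Option.bind r (\<lambda>y. eval A g (prod_encode (a, prod_encode (k, y))))) n)"
| "eval A (Mu f) = (\<lambda>x.
     if \<exists>n. eval A f (prod_encode (x, n)) = Some 0 \<and>
            (\<forall>k<n. eval A f (prod_encode (x, k)) \<noteq> None)
     then Some (LEAST n. eval A f (prod_encode (x, n)) = Some 0)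
     else None)"

primrec recfun_code :: "recfun \<Rightarrow> nat" where
  "recfun_code Zero = 0"
| "recfun_code Succ = 1"
| "recfun_code Fst = 2"
| "recfun_code Snd = 3"
| "recfun_code Query = 4"
| "recfun_code (Pairing f g) = 5 + 4 * prod_encode (recfun_code f, recfun_code g)"
| "recfun_code (Comp f g) = 6 + 4 * prod_encode (recfun_code f, recfun_code g)"
| "recfun_code (PrimRec f g) = 7 + 4 * prod_encode (recfun_code f, recfun_code g)"
| "recfun_code (Mu f) = 8 + 4 * recfun_code f"

lemma recfun_code_inject: "recfun_code f = recfun_code g \<longleftrightarrow> f = g"
proof (induction f arbitrary: g)
  case (Pairing f1 f2) then show ?case by (cases g) (simp_all, presburger+)
next
  case (Comp f1 f2) then show ?case by (cases g) (simp_all, presburger+)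
next
  case (PrimRec f1 f2) then show ?case by (cases g) (simp_all, presburger+)
next
  case (Mu f) then show ?case by (cases g) (simp_all, presburger+)
qed (case_tac g; simp)+

text \<open>
  Unrelativized computability is computability relative to the empty set (\<^const>\<open>Query\<close> is then
  the constant function 0), so the set below is the jump of the empty set.
\<close>

definition halting_problem :: "nat set" where
  "halting_problem = {prod_encode (recfun_code f, x) | f x. eval {} f x \<noteq> None}"

definition computable :: "(nat \<Rightarrow> nat) \<Rightarrow> bool" where
  "computable f \<longleftrightarrow> (\<exists>e. \<forall>n. eval {} e n = Some (f n))"

definition computable_seq :: "(nat \<Rightarrow> bool) \<Rightarrow> bool" where
  "computable_seq \<alpha> \<longleftrightarrow> computable (\<lambda>n. of_bool (\<alpha> n))"

text \<open>
  Bijective base-2 numeration (least significant digit first): strings of length \<open>k\<close> correspond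
  to the numbers from \<open>2 ^ k - 1\<close> to \<open>2 ^ (k + 1) - 2\<close>.
\<close>

primrec str_code :: "bool list \<Rightarrow> nat" where
  "str_code [] = 0"
| "str_code (b # bs) = (if b then 2 else 1) + 2 * str_code bs"

lemma str_code_inject: "str_code x = str_code y \<longleftrightarrow> x = y"
proof (induction x arbitrary: y)
  case Nil then show ?case by (cases y) auto
next
  case (Cons b x)
  show ?case
  proof (cases y)
    case (Cons d z)
    have "str_code (b # x) = str_code (d # z) \<longleftrightarrow> b = d \<and> str_code x = str_code z"
      by (cases b; cases d; simp; presburger)
    then show ?thesis using Cons Cons.IH by simp
  qed simp
qed

text \<open>
  A programming language with access to \<open>A\<close> is a partial function of a program and a natural
  number that is partial recursive in \<open>A\<close>; \<^const>\<open>None\<close> means divergence.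
\<close>

definition prog_lang :: "nat set \<Rightarrow> (bool list \<Rightarrow> nat \<Rightarrow> bool list option) \<Rightarrow> bool" where
  "prog_lang A V \<longleftrightarrow>
     (\<exists>e. \<forall>p n. eval A e (prod_encode (str_code p, n)) = map_option str_code (V p n))"

text \<open>The equation \<open>U q = V p\<close> includes agreement of the domains of the two partial functions.\<close>

definition optimal :: "nat set \<Rightarrow> (bool list \<Rightarrow> nat \<Rightarrow> bool list option) \<Rightarrow> bool" where
  "optimal A U \<longleftrightarrow> prog_lang A U \<and>
     (\<forall>V. prog_lang A V \<longrightarrow> (\<exists>c. \<forall>p. \<exists>q. length q \<le> length p + c \<and> U q = V p))"

definition seq_prefix :: "(nat \<Rightarrow> bool) \<Rightarrow> nat \<Rightarrow> bool list" where
  "seq_prefix \<alpha> n = map \<alpha> [0..<n]"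

text \<open>
  In \<^typ>\<open>enat\<close> an infimum of a nonempty set is its minimum, and the infimum of the empty set
  (no program at all) is \<open>\<infinity>\<close>.
\<close>

definition cond_complexity ::
    "(bool list \<Rightarrow> nat \<Rightarrow> bool list option) \<Rightarrow> bool list \<Rightarrow> nat \<Rightarrow> enat" where
  "cond_complexity U x n = (INF p \<in> {p. U p n = Some x}. enat (length p))"

definition seq_complexity ::
    "(bool list \<Rightarrow> nat \<Rightarrow> bool list option) \<Rightarrow> (nat \<Rightarrow> bool) \<Rightarrow> enat" where
  "seq_complexity U \<alpha> =
     (INF p \<in> {p. \<forall>n. U p n = Some (seq_prefix \<alpha> n)}. enat (length p))"

definition M_infinity ::
    "(bool list \<Rightarrow> nat \<Rightarrow> bool list option) \<Rightarrow> (nat \<Rightarrow> bool) \<Rightarrow> enat" where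
  "M_infinity U \<alpha> = limsup (\<lambda>n. cond_complexity U (seq_prefix \<alpha> n) n)"

end

theory Submission imports Defs begin

text \<open>
  Fix \<open>m\<close> and a bound \<open>B\<close> on the codes of the programs of length less than \<open>f m\<close>. Given \<open>N\<close>, let
  \<open>d\<close> be the largest number of these programs that halt on a common input \<open>n \<ge> N + B\<close>. Once \<open>d\<close>
  is known, a search finds such an \<open>n\<close> and the outputs of \<open>d\<close> programs on it, and by maximality
  no other program below \<open>B\<close> halts on \<open>n\<close>. So the bits at the positions \<open>N + i\<close>, \<open>i < B\<close>, can be
  chosen such that the prefix of length \<open>n\<close> differs from all outputs. Then repeat with \<open>n\<close> in place
  of \<open>N\<close>. The number \<open>d\<close> is computable from \<open>0'\<close>, uniformly in \<open>m\<close>. For fixed \<open>m\<close> it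
  is nonincreasing in \<open>N\<close>, hence eventually constant, so the resulting sequence is computable.
\<close>

abbreviation pfst :: "nat \<Rightarrow> nat" where "pfst z \<equiv> fst (prod_decode z)"
abbreviation psnd :: "nat \<Rightarrow> nat" where "psnd z \<equiv> snd (prod_decode z)"

section \<open>Relative computability of total functions\<close>

definition computable_in :: "nat set \<Rightarrow> (nat \<Rightarrow> nat) \<Rightarrow> bool" where
  "computable_in A f \<longleftrightarrow> (\<exists>e. \<forall>n. eval A e n = Some (f n))"

abbreviation decidable_in :: "nat set \<Rightarrow> (nat \<Rightarrow> bool) \<Rightarrow> bool" where
  "decidable_in A P \<equiv> computable_in A (\<lambda>x. of_bool (P x))"

lemma computable_in_empty: "computable_in {} f \<longleftrightarrow> computable f"
  by (simp add: computable_in_def computable_def)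

text \<open>With the empty oracle \<open>Query\<close> always answers 0, so putting
  \<open>Zero\<close> in its place yields a program with the same values under every oracle.
  Oracle-free computability thus carries over to any oracle.\<close>

primrec drop_query :: "recfun \<Rightarrow> recfun" where
  "drop_query Zero = Zero"
| "drop_query Succ = Succ"
| "drop_query Fst = Fst"
| "drop_query Snd = Snd"
| "drop_query Query = Zero"
| "drop_query (Pairing f g) = Pairing (drop_query f) (drop_query g)"
| "drop_query (Comp f g) = Comp (drop_query f) (drop_query g)"
| "drop_query (PrimRec f g) = PrimRec (drop_query f) (drop_query g)"
| "drop_query (Mu f) = Mu (drop_query f)"

lemma eval_drop_query: "eval A (drop_query e) = eval {} e"
  by (induction e) (simp_all cong: if_cong)

lemma computable_in_mono: "computable_in {} f \<Longrightarrow> computable_in A f"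
  unfolding computable_in_def by (metis eval_drop_query)

lemma computable_in_compose:
  assumes "computable_in A f" "computable_in A g"
  shows "computable_in A (\<lambda>x. f (g x))"
proof -
  obtain e d where "\<forall>n. eval A e n = Some (f n)" "\<forall>n. eval A d n = Some (g n)"
    using assms unfolding computable_in_def by blast
  then have "\<forall>n. eval A (Comp e d) n = Some (f (g n))" by simp
  then show ?thesis unfolding computable_in_def by blast
qed

lemma computable_in_pair:
  assumes "computable_in A f" "computable_in A g"
  shows "computable_in A (\<lambda>x. prod_encode (f x, g x))"
proof -
  obtain e d where "\<forall>n. eval A e n = Some (f n)" "\<forall>n. eval A d n = Some (g n)"
    using assms unfolding computable_in_def by blast
  then have "\<forall>n. eval A (Pairing e d) n = Some (prod_encode (f n, g n))" by simp
  then show ?thesis unfolding computable_in_def by blast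
qed

text \<open>Computability of a curried binary function is expressed through the projections; this
  rule converts back to ordinary arguments.\<close>

lemma computable_in_compose2:
  assumes "computable_in A (\<lambda>z. F (pfst z) (psnd z))" "computable_in A f" "computable_in A g"
  shows "computable_in A (\<lambda>x. F (f x) (g x))"
  using computable_in_compose[OF assms(1) computable_in_pair[OF assms(2,3)]] by simp

lemma computable_in_pfst: "computable_in A f \<Longrightarrow> computable_in A (\<lambda>x. pfst (f x))"
  by (rule computable_in_compose[where f = pfst]) (auto simp: computable_in_def intro: exI[of _ Fst])

lemma computable_in_psnd: "computable_in A f \<Longrightarrow> computable_in A (\<lambda>x. psnd (f x))"
  by (rule computable_in_compose[where f = psnd]) (auto simp: computable_in_def intro: exI[of _ Snd])

lemma computable_in_Suc: "computable_in A f \<Longrightarrow> computable_in A (\<lambda>x. Suc (f x))"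
  by (rule computable_in_compose[where f = Suc]) (auto simp: computable_in_def intro: exI[of _ Succ])

lemma computable_in_mem: "computable_in A f \<Longrightarrow> decidable_in A (\<lambda>x. f x \<in> A)"
  by (rule computable_in_compose[where f = "\<lambda>x. of_bool (x \<in> A)"])
    (auto simp: computable_in_def intro!: exI[of _ Query])

lemma computable_in_id: "computable_in A (\<lambda>x. x)"
  unfolding computable_in_def by (rule exI[of _ "Pairing Fst Snd"]) simp

lemma computable_in_const: "computable_in A (\<lambda>x. c)"
proof (induction c)
  case 0
  show ?case unfolding computable_in_def by (rule exI[of _ Zero]) simp
qed (rule computable_in_Suc)

lemma computable_in_rec:
  assumes f: "computable_in A f" and h: "computable_in A h"
    and g: "computable_in A (\<lambda>z. g (pfst z) (pfst (psnd z)) (psnd (psnd z)))"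
  shows "computable_in A (\<lambda>x. rec_nat (f x) (\<lambda>k r. g x k r) (h x))"
proof -
  obtain e d where e: "\<And>n. eval A e n = Some (f n)"
    and d: "\<And>z. eval A d z = Some (g (pfst z) (pfst (psnd z)) (psnd (psnd z)))"
    using f g unfolding computable_in_def by blast
  have "rec_nat (Some (f x)) (\<lambda>k r. Option.bind r (\<lambda>y. eval A d (prod_encode (x, prod_encode (k, y))))) n
    = Some (rec_nat (f x) (\<lambda>k r. g x k r) n)" for x n
    by (induction n) (simp_all add: d)
  then have "\<forall>z. eval A (PrimRec e d) z = Some (rec_nat (f (pfst z)) (\<lambda>k r. g (pfst z) k r) (psnd z))"
    by (simp add: e split: prod.split)
  then have "computable_in A (\<lambda>z. rec_nat (f (pfst z)) (\<lambda>k r. g (pfst z) k r) (psnd z))"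
    unfolding computable_in_def by blast
  then show ?thesis by (rule computable_in_compose2[OF _ computable_in_id h])
qed

lemmas computable_in_basic = computable_in_const computable_in_id computable_in_pair
  computable_in_pfst computable_in_psnd computable_in_Suc computable_in_rec

section \<open>Arithmetic, Boolean operations and case distinction\<close>

lemma computable_in_pred:
  assumes "computable_in A f" shows "computable_in A (\<lambda>x. f x - 1)"
proof -
  have "computable_in A (\<lambda>x. rec_nat 0 (\<lambda>k r. k) (f x))"
    by (intro computable_in_basic assms)
  moreover have "rec_nat 0 (\<lambda>k r. k) n = n - 1" for n :: nat by (cases n) auto
  ultimately show ?thesis by simp
qed

lemma computable_in_add:
  assumes "computable_in A f" "computable_in A g" shows "computable_in A (\<lambda>x. f x + g x)"
proof -
  have "computable_in A (\<lambda>x. rec_nat (f x) (\<lambda>k r. Suc r) (g x))"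
    by (intro computable_in_basic assms)
  moreover have "rec_nat m (\<lambda>k r. Suc r) n = m + n" for m n :: nat by (induction n) auto
  ultimately show ?thesis by simp
qed

lemma computable_in_diff:
  assumes "computable_in A f" "computable_in A g" shows "computable_in A (\<lambda>x. f x - g x)"
proof -
  have "computable_in A (\<lambda>x. rec_nat (f x) (\<lambda>k r. r - 1) (g x))"
    by (intro computable_in_basic computable_in_pred assms)
  moreover have "rec_nat m (\<lambda>k r. r - 1) n = m - n" for m n :: nat by (induction n) auto
  ultimately show ?thesis by simp
qed

lemma computable_in_mult:
  assumes "computable_in A f" "computable_in A g" shows "computable_in A (\<lambda>x. f x * g x)"
proof -
  have "computable_in A (\<lambda>x. rec_nat 0 (\<lambda>k r. r + f x) (g x))"
    by (intro computable_in_basic computable_in_add computable_in_compose[OF assms(1)] assms(2))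
  moreover have "rec_nat 0 (\<lambda>k r. r + m) n = m * n" for m n :: nat by (induction n) auto
  ultimately show ?thesis by simp
qed

lemma computable_in_power2:
  assumes "computable_in A f" shows "computable_in A (\<lambda>x. 2 ^ f x)"
proof -
  have "computable_in A (\<lambda>x. rec_nat 1 (\<lambda>k r. r + r) (f x))"
    by (intro computable_in_basic computable_in_add assms)
  moreover have "rec_nat 1 (\<lambda>k r. r + r) n = (2::nat) ^ n" for n :: nat by (induction n) auto
  ultimately show ?thesis by simp
qed

lemma decidable_in_not:
  assumes "decidable_in A P" shows "decidable_in A (\<lambda>x. \<not> P x)"
proof -
  have "computable_in A (\<lambda>x. 1 - of_bool (P x))"
    by (intro computable_in_basic computable_in_diff assms)
  moreover have "1 - of_bool (P x) = (of_bool (\<not> P x) :: nat)" for x by simp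
  ultimately show ?thesis by simp
qed

lemma decidable_in_and:
  assumes "decidable_in A P" "decidable_in A Q" shows "decidable_in A (\<lambda>x. P x \<and> Q x)"
  using computable_in_mult[OF assms] by (simp only: of_bool_conj)

lemma decidable_in_or:
  assumes "decidable_in A P" "decidable_in A Q" shows "decidable_in A (\<lambda>x. P x \<or> Q x)"
  using decidable_in_not[OF decidable_in_and[OF assms[THEN decidable_in_not]]] by simp

lemma decidable_in_le:
  assumes "computable_in A f" "computable_in A g" shows "decidable_in A (\<lambda>x. f x \<le> g x)"
proof -
  have "computable_in A (\<lambda>x. 1 - (f x - g x))"
    by (intro computable_in_basic computable_in_diff assms)
  moreover have "1 - (f x - g x) = of_bool (f x \<le> g x)" for x by simp
  ultimately show ?thesis by (simp only:)
qed

lemma decidable_in_less: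
  assumes "computable_in A f" "computable_in A g" shows "decidable_in A (\<lambda>x. f x < g x)"
  using decidable_in_le[OF computable_in_Suc[OF assms(1)] assms(2)] by (simp only: Suc_le_eq)

lemma decidable_in_eq:
  assumes "computable_in A f" "computable_in A g" shows "decidable_in A (\<lambda>x. f x = g x)"
  using decidable_in_and[OF decidable_in_le[OF assms] decidable_in_le[OF assms(2,1)]]
  by (simp only: order_eq_iff[of "_ :: nat"])

lemma computable_in_if:
  assumes "decidable_in A P" "computable_in A f" "computable_in A g"
  shows "computable_in A (\<lambda>x. if P x then f x else g x)"
proof -
  have "computable_in A (\<lambda>x. of_bool (P x) * f x + of_bool (\<not> P x) * g x)"
    by (intro computable_in_add computable_in_mult decidable_in_not assms)
  moreover have "of_bool (P x) * f x + of_bool (\<not> P x) * g x = (if P x then f x else g x)" for x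
    by simp
  ultimately show ?thesis by (simp only:)
qed

lemmas computable_in_arith = computable_in_basic computable_in_add computable_in_diff
  computable_in_mult computable_in_power2 computable_in_if decidable_in_not decidable_in_and
  decidable_in_or decidable_in_le decidable_in_less decidable_in_eq

section \<open>Bounded sums, unbounded search and the halting oracle\<close>

lemma computable_in_sum:
  assumes "computable_in A (\<lambda>z. f (pfst z) (psnd z))" "computable_in A h"
  shows "computable_in A (\<lambda>x. \<Sum>i<h x. f x i)"
proof -
  have "computable_in A (\<lambda>x. rec_nat 0 (\<lambda>k r. r + f x k) (h x))"
    by (intro computable_in_arith computable_in_compose2[OF assms(1)] assms(2))
  moreover have "rec_nat 0 (\<lambda>k r. r + f x k) n = (\<Sum>i<n. f x i)" for x n
    by (induction n) auto
  ultimately show ?thesis by simp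
qed

text \<open>\<open>Mu\<close> looks for the value 0, hence the negation. Since \<open>e\<close> is
  total, convergence at smaller arguments is automatic.\<close>

lemma eval_Mu_total:
  assumes "\<And>z. eval A e z = Some (of_bool (\<not> P (pfst z) (psnd z)))"
  shows "eval A (Mu e) x = (if \<exists>n. P x n then Some (LEAST n. P x n) else None)"
  by (simp add: assms)

lemma computable_in_Least:
  assumes "decidable_in A (\<lambda>z. P (pfst z) (psnd z))" and "\<And>x. \<exists>n. P x n"
  shows "computable_in A (\<lambda>x. LEAST n. P x n)"
proof -
  obtain e where "\<And>z. eval A e z = Some (of_bool (\<not> P (pfst z) (psnd z)))"
    using decidable_in_not[OF assms(1)] unfolding computable_in_def by blast
  from eval_Mu_total[OF this] show ?thesis
    unfolding computable_in_def using assms(2) by (intro exI[of _ "Mu e"]) simp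
qed

text \<open>The oracle-free search \<open>Mu e\<close> halts on x exactly when a witness exists, so
  a single query decides the question.\<close>

lemma decidable_in_halting_Ex:
  assumes "decidable_in {} (\<lambda>z. P (pfst z) (psnd z))"
  shows "decidable_in halting_problem (\<lambda>x. \<exists>n. P x n)"
proof -
  obtain e where "\<And>z. eval {} e z = Some (of_bool (\<not> P (pfst z) (psnd z)))"
    using decidable_in_not[OF assms(1)] unfolding computable_in_def by blast
  from eval_Mu_total[OF this]
  have "(\<exists>n. P x n) \<longleftrightarrow> prod_encode (recfun_code (Mu e), x) \<in> halting_problem" for x
    unfolding halting_problem_def by (auto simp: recfun_code_inject simp del: recfun_code.simps eval.simps)
  moreover have "decidable_in halting_problem
      (\<lambda>x. prod_encode (recfun_code (Mu e), x) \<in> halting_problem)"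
    by (intro computable_in_basic computable_in_mem)
  ultimately show ?thesis by simp
qed

text \<open>Finitely many exceptional values can be hardwired into a program; the induction peels
  off the value at 0.\<close>

lemma computable_in_eventually_const:
  assumes "\<And>n. n \<ge> N \<Longrightarrow> g n = c"
  shows "computable_in A g"
  using assms
proof (induction N arbitrary: g)
  case 0
  then have "g = (\<lambda>n. c)" by auto
  then show ?case by (simp add: computable_in_const)
next
  case (Suc N)
  have "computable_in A (\<lambda>n. g (Suc n))" by (rule Suc.IH) (simp add: Suc.prems)
  then have "computable_in A (\<lambda>n. if n = 0 then g 0 else g (Suc (n - 1)))"
    by (intro computable_in_arith computable_in_compose[OF \<open>computable_in A (\<lambda>n. g (Suc n))\<close>])
  moreover have "(if n = 0 then g 0 else g (Suc (n - 1))) = g n" for n by simp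
  ultimately show ?case by (simp only:)
qed

section \<open>Clocked evaluation\<close>

text \<open>
  The clock makes it possible to run the programs in parallel; the value \<open>0\<close> stands for
  ``no result yet'' and \<open>Suc y\<close> for the result \<open>y\<close>.
\<close>

definition clocks :: "(nat \<Rightarrow> nat \<Rightarrow> nat) \<Rightarrow> (nat \<Rightarrow> nat option) \<Rightarrow> bool" where
  "clocks T F \<longleftrightarrow> computable_in {} (\<lambda>z. T (pfst z) (psnd z)) \<and>
     (\<forall>x s y. T x s = Suc y \<longrightarrow> F x = Some y) \<and>
     (\<forall>x y. F x = Some y \<longrightarrow> (\<forall>\<^sub>F s in sequentially. T x s = Suc y))"

lemma clocks_computable:
  assumes "clocks T F" "computable_in A f" "computable_in A g"
  shows "computable_in A (\<lambda>x. T (f x) (g x))"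
  using assms computable_in_compose2 computable_in_mono unfolding clocks_def by blast

lemma clocks_sound: "clocks T F \<Longrightarrow> T x s = Suc y \<Longrightarrow> F x = Some y"
  unfolding clocks_def by blast

text \<open>Asking for the result at all late clocks, not just at one, lets finitely many runs share
  a common clock.\<close>

lemma clocks_complete: "clocks T F \<Longrightarrow> F x = Some y \<Longrightarrow> \<forall>\<^sub>F s in sequentially. T x s = Suc y"
  unfolding clocks_def by blast

lemma clocks_total: "computable_in {} f \<Longrightarrow> clocks (\<lambda>x s. Suc (f x)) (\<lambda>x. Some (f x))"
  unfolding clocks_def
  by (auto intro!: computable_in_Suc computable_in_pfst computable_in_id elim!: computable_in_compose)

lemma clocks_Pairing:
  assumes "clocks S (eval {} f)" "clocks T (eval {} g)"
  shows "clocks (\<lambda>x s. if S x s = 0 \<or> T x s = 0 then 0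
    else Suc (prod_encode (S x s - 1, T x s - 1))) (eval {} (Pairing f g))" (is "clocks ?R _")
  unfolding clocks_def
proof (intro conjI allI impI)
  show "computable_in {} (\<lambda>z. ?R (pfst z) (psnd z))"
    by (intro computable_in_arith clocks_computable[OF assms(1)] clocks_computable[OF assms(2)])
next
  fix x s y assume "?R x s = Suc y"
  then obtain u v where "S x s = Suc u" "T x s = Suc v" "y = prod_encode (u, v)"
    by (cases "S x s"; cases "T x s") auto
  then show "eval {} (Pairing f g) x = Some y"
    using assms[THEN clocks_sound] by simp
next
  fix x y assume "eval {} (Pairing f g) x = Some y"
  then obtain u v where uv: "eval {} f x = Some u" "eval {} g x = Some v" "y = prod_encode (u, v)"
    by (auto simp: bind_eq_Some_conv)
  show "\<forall>\<^sub>F s in sequentially. ?R x s = Suc y"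
    using clocks_complete[OF assms(1) uv(1)] clocks_complete[OF assms(2) uv(2)]
    by eventually_elim (simp add: uv)
qed

lemma clocks_Comp:
  assumes "clocks S (eval {} f)" "clocks T (eval {} g)"
  shows "clocks (\<lambda>x s. if T x s = 0 then 0 else S (T x s - 1) s) (eval {} (Comp f g))"
    (is "clocks ?R _")
  unfolding clocks_def
proof (intro conjI allI impI)
  show "computable_in {} (\<lambda>z. ?R (pfst z) (psnd z))"
    by (intro computable_in_arith clocks_computable[OF assms(1)] clocks_computable[OF assms(2)])
next
  fix x s y assume "?R x s = Suc y"
  then obtain u where "T x s = Suc u" "S u s = Suc y" by (cases "T x s") auto
  then show "eval {} (Comp f g) x = Some y"
    using assms[THEN clocks_sound] by simp
next
  fix x y assume "eval {} (Comp f g) x = Some y"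
  then obtain u where u: "eval {} g x = Some u" "eval {} f u = Some y"
    by (auto simp: bind_eq_Some_conv)
  show "\<forall>\<^sub>F s in sequentially. ?R x s = Suc y"
    using clocks_complete[OF assms(1) u(2)] clocks_complete[OF assms(2) u(1)]
    by eventually_elim simp
qed

text \<open>Every stage of the recursion runs with the same clock. A finished recursion has finitely
  many stages, so some clock serves all of them.\<close>

lemma clocks_PrimRec:
  assumes "clocks S (eval {} f)" "clocks T (eval {} g)"
  shows "clocks (\<lambda>x s. rec_nat (S (pfst x) s)
    (\<lambda>k r. if r = 0 then 0 else T (prod_encode (pfst x, prod_encode (k, r - 1))) s) (psnd x))
    (eval {} (PrimRec f g))"
proof -
  define R where "R a s = rec_nat (S a s)
    (\<lambda>k r. if r = 0 then 0 else T (prod_encode (a, prod_encode (k, r - 1))) s)" for a s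
  define E where "E a = rec_nat (eval {} f a)
       (\<lambda>k r. Option.bind r (\<lambda>y. eval {} g (prod_encode (a, prod_encode (k, y)))))" for a
  have comp: "computable_in {} (\<lambda>z. R (pfst (pfst z)) (psnd z) (psnd (pfst z)))"
    unfolding R_def
    by (intro computable_in_arith clocks_computable[OF assms(1)] clocks_computable[OF assms(2)])
  have sound: "R a s n = Suc y \<Longrightarrow> E a n = Some y" for a s n y
  proof (induction n arbitrary: y)
    case 0
    then show ?case using clocks_sound[OF assms(1)] by (simp add: R_def E_def)
  next
    case (Suc n)
    then obtain u where "R a s n = Suc u" by (cases "R a s n") (auto simp: R_def)
    then show ?case
      using Suc clocks_sound[OF assms(2)] by (auto simp: R_def E_def)
  qed
  have complete: "E a n = Some y \<Longrightarrow> \<forall>\<^sub>F s in sequentially. R a s n = Suc y" for a n y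
  proof (induction n arbitrary: y)
    case 0
    then show ?case using clocks_complete[OF assms(1)] by (simp add: R_def E_def)
  next
    case (Suc n)
    then obtain u where u: "E a n = Some u" "eval {} g (prod_encode (a, prod_encode (n, u))) = Some y"
      by (auto simp: E_def bind_eq_Some_conv)
    show ?case
      using Suc.IH[OF u(1)] clocks_complete[OF assms(2) u(2)]
      by eventually_elim (simp add: R_def)
  qed
  have "eval {} (PrimRec f g) = (\<lambda>x. E (pfst x) (psnd x))"
    by (simp add: E_def case_prod_unfold)
  then show ?thesis
    using comp sound complete unfolding clocks_def R_def[symmetric] by simp
qed

lemma clocks_Mu:
  assumes "clocks T (eval {} f)"
  shows "\<exists>R. clocks R (eval {} (Mu f))"
proof -
  \<comment> \<open>The search stops at the first n whose run has no result yet (0) or the result 0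
    (1); the bound s makes it total.\<close>
  define l where "l x s = (LEAST n. s \<le> n \<or> T (prod_encode (x, n)) s \<le> 1)" for x s
  \<comment> \<open>Only a stop at the result 0 is reported, so an unfinished run at a smaller
    argument never lets a later zero through.\<close>
  let ?R = "\<lambda>x s. if l x s < s \<and> T (prod_encode (x, l x s)) s = 1 then Suc (l x s) else 0"
  have l: "computable_in {} (\<lambda>z. l (pfst z) (psnd z))"
    unfolding l_def
    by (intro computable_in_Least computable_in_arith clocks_computable[OF assms]) auto
  have "clocks ?R (eval {} (Mu f))"
    unfolding clocks_def
  proof (intro conjI allI impI)
    show "computable_in {} (\<lambda>z. ?R (pfst z) (psnd z))"
      by (intro computable_in_arith clocks_computable[OF assms] l)
  next
    fix x s y assume R: "?R x s = Suc y"
    then have y: "y = l x s" "y < s" "T (prod_encode (x, y)) s = Suc 0"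
      by (auto split: if_splits)
    have 0: "eval {} f (prod_encode (x, y)) = Some 0"
      by (rule clocks_sound[OF assms y(3)])
    have nz: "\<exists>v. eval {} f (prod_encode (x, k)) = Some (Suc v)" if "k < y" for k
    proof -
      have "\<not> (s \<le> k \<or> T (prod_encode (x, k)) s \<le> 1)"
        using not_less_Least that unfolding y(1) l_def by blast
      then obtain v where "T (prod_encode (x, k)) s = Suc (Suc v)"
        by (cases "T (prod_encode (x, k)) s"; cases "T (prod_encode (x, k)) s - 1") auto
      from clocks_sound[OF assms this] show ?thesis by blast
    qed
    have "(LEAST n. eval {} f (prod_encode (x, n)) = Some 0) = y"
      using 0 nz by (intro Least_equality) (auto, metis leI nat.distinct(1) option.inject)
    then show "eval {} (Mu f) x = Some y" using 0 nz by force
  next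
    fix x y assume Mu: "eval {} (Mu f) x = Some y"
    then obtain n where n: "eval {} f (prod_encode (x, n)) = Some 0"
      "\<forall>k<n. eval {} f (prod_encode (x, k)) \<noteq> None"
      and y: "y = (LEAST n. eval {} f (prod_encode (x, n)) = Some 0)"
      by (auto split: if_splits)
    have 0: "eval {} f (prod_encode (x, y)) = Some 0"
      unfolding y by (rule LeastI[of _ n]) (rule n(1))
    have "y \<le> n" unfolding y by (rule Least_le) (rule n(1))
    have nz: "\<exists>v. eval {} f (prod_encode (x, k)) = Some (Suc v)" if "k < y" for k
    proof -
      obtain w where w: "eval {} f (prod_encode (x, k)) = Some w"
        using n(2) \<open>y \<le> n\<close> \<open>k < y\<close> by fastforce
      moreover have "w \<noteq> 0" using w not_less_Least[OF that[unfolded y]] by auto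
      ultimately show ?thesis by (cases w) auto
    qed
    then obtain v where v: "\<And>k. k < y \<Longrightarrow> eval {} f (prod_encode (x, k)) = Some (Suc (v k))"
      by metis
    have "\<forall>\<^sub>F s in sequentially. \<forall>k\<in>{..<y}. T (prod_encode (x, k)) s = Suc (Suc (v k))"
      by (intro eventually_ball_finite ballI clocks_complete[OF assms]) (auto simp: v)
    moreover have "\<forall>\<^sub>F s in sequentially. T (prod_encode (x, y)) s = Suc 0"
      by (rule clocks_complete[OF assms 0])
    ultimately show "\<forall>\<^sub>F s in sequentially. ?R x s = Suc y"
      using eventually_gt_at_top[of y]
    proof eventually_elim
      case (elim s)
      \<comment> \<open>At such a clock the runs below y have nonzero results and the run at y has
        the result 0.\<close>
      then have "l x s = y"
        unfolding l_def by (intro Least_equality leI) auto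
      with elim show ?case by simp
    qed
  qed
  then show ?thesis by blast
qed

lemma clocks_exists: "\<exists>T. clocks T (eval {} e)"
proof (induction e)
  case (Pairing f g) then show ?case using clocks_Pairing by blast
next
  case (Comp f g) then show ?case using clocks_Comp by blast
next
  case (PrimRec f g) then show ?case using clocks_PrimRec by blast
next
  case (Mu f) then show ?case using clocks_Mu by blast
qed (force simp del: One_nat_def intro: exI clocks_total computable_in_basic)+

section \<open>Digits of coded strings\<close>

text \<open>In bijective base 2 the code of a nonempty string is even iff its first bit is true, and
  \<open>(r - 1) div 2\<close> drops that bit. Values past the end of the string carry no
  meaning.\<close>

definition digit :: "nat \<Rightarrow> nat \<Rightarrow> bool" where
  "digit v i \<longleftrightarrow> even (rec_nat v (\<lambda>k r. (r - 1) div 2) i)"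

lemma digit_str_code: "i < length xs \<Longrightarrow> digit (str_code xs) i = xs ! i"
proof (induction i arbitrary: xs)
  case 0
  then show ?case by (cases xs) (auto simp: digit_def)
next
  case (Suc i)
  \<comment> \<open>\<open>rec_nat\<close> adds the new step outermost; regrouping drops the first
    bit first, which matches the structure of \<open>xs\<close>.\<close>
  have shift: "digit v (Suc i) = digit ((v - 1) div 2) i" for v
  proof -
    have "rec_nat v (\<lambda>k r. (r - 1) div 2) (Suc i) = rec_nat ((v - 1) div 2) (\<lambda>k r. (r - 1) div 2) i"
      by (induction i) auto
    then show ?thesis by (simp add: digit_def)
  qed
  from Suc show ?case by (cases xs) (auto simp: shift)
qed

lemma computable_in_half:
  assumes "computable_in A f" shows "computable_in A (\<lambda>x. f x div 2)"
proof -
  have "computable_in A (\<lambda>x. LEAST q. f x < 2 * Suc q)"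
    by (intro computable_in_Least computable_in_arith computable_in_compose[OF assms]) presburger
  moreover have "(LEAST q. n < 2 * Suc q) = n div 2" for n :: nat
    by (rule Least_equality) auto
  ultimately show ?thesis by simp
qed

lemma decidable_in_digit:
  assumes "computable_in A f" "computable_in A g" shows "decidable_in A (\<lambda>x. digit (f x) (g x))"
proof -
  have "decidable_in A (\<lambda>x. 2 * (rec_nat (f x) (\<lambda>k r. (r - 1) div 2) (g x) div 2)
      = rec_nat (f x) (\<lambda>k r. (r - 1) div 2) (g x))"
    by (intro computable_in_arith computable_in_half assms)
  moreover have "2 * (n div 2) = n \<longleftrightarrow> even n" for n :: nat by presburger
  ultimately show ?thesis unfolding digit_def by simp
qed

lemma str_code_snoc: "str_code (xs @ [b]) = str_code xs + (1 + of_bool b) * 2 ^ length xs"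
  by (induction xs) auto

text \<open>As an explicit sum, the code of a prefix is computable from the bits without any
  processing of strings.\<close>

lemma str_code_seq_prefix: "str_code (seq_prefix \<alpha> n) = (\<Sum>i<n. (1 + of_bool (\<alpha> i)) * 2 ^ i)"
  by (induction n) (simp_all add: seq_prefix_def str_code_snoc)

lemma str_code_less: "str_code xs < 2 ^ Suc (length xs) - 1"
  by (induction xs) auto

lemma str_code_replicate: "Suc (str_code (replicate n False)) = 2 ^ n"
  by (induction n) auto

section \<open>The diagonal sequence\<close>

text \<open>The number t packs an input and a clock, so that one unbounded search finds both.
  Programs are represented by their codes i.\<close>

definition halted :: "(nat \<Rightarrow> nat \<Rightarrow> nat) \<Rightarrow> nat \<Rightarrow> nat \<Rightarrow> nat" where
  "halted T B t = (\<Sum>i<B. of_bool (T (prod_encode (i, pfst t)) (psnd t) \<noteq> 0))"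

definition good :: "(nat \<Rightarrow> nat \<Rightarrow> nat) \<Rightarrow> nat \<Rightarrow> nat \<Rightarrow> nat \<Rightarrow> nat \<Rightarrow> bool" where
  "good T B N d t \<longleftrightarrow> N + B \<le> pfst t \<and> d \<le> halted T B t"

text \<open>Since \<open>good\<close> is downward closed in d, this is the maximal attainable d. The
  form with \<open>LEAST\<close> turns it into a search through existential questions.\<close>

definition max_halting :: "(nat \<Rightarrow> nat \<Rightarrow> nat) \<Rightarrow> nat \<Rightarrow> nat \<Rightarrow> nat" where
  "max_halting T B N = (LEAST d. \<not> (\<exists>t. good T B N (Suc d) t))"

text \<open>
  A block starting at \<open>N\<close> is coded as \<open>(N, (n, s))\<close>: it covers the positions from \<open>N\<close> to \<open>n - 1\<close>,
  and the programs are run on the input \<open>n\<close> with clock \<open>s\<close>.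
\<close>

definition block :: "(nat \<Rightarrow> nat \<Rightarrow> nat) \<Rightarrow> nat \<Rightarrow> (nat \<Rightarrow> nat) \<Rightarrow> nat \<Rightarrow> nat" where
  "block T B D N = prod_encode (N, LEAST t. good T B N (D N) t)"

text \<open>Recursion on the position, rather than on the index of the block, makes this a plain
  primitive recursion.\<close>

definition block_at :: "(nat \<Rightarrow> nat \<Rightarrow> nat) \<Rightarrow> nat \<Rightarrow> (nat \<Rightarrow> nat) \<Rightarrow> nat \<Rightarrow> nat" where
  "block_at T B D x = rec_nat (block T B D 0)
     (\<lambda>k r. if Suc k < pfst (psnd r) then r else block T B D (Suc k)) x"

text \<open>In a block starting at N, position N + i is reserved for program i: its bit contradicts
  the output of that program on the end of the block. Where no output is available the bit is
  arbitrary.\<close>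

definition diag :: "(nat \<Rightarrow> nat \<Rightarrow> nat) \<Rightarrow> nat \<Rightarrow> (nat \<Rightarrow> nat) \<Rightarrow> nat \<Rightarrow> bool" where
  "diag T B D x = (let r = block_at T B D x; t = psnd r in
     \<not> digit (T (prod_encode (x - pfst r, pfst t)) (psnd t) - 1) x)"

lemma decidable_in_good:
  assumes "clocks T F" "computable_in A b" "computable_in A g" "computable_in A d" "computable_in A h"
  shows "decidable_in A (\<lambda>x. good T (b x) (g x) (d x) (h x))"
  unfolding good_def halted_def
  by (intro computable_in_arith computable_in_sum clocks_computable[OF assms(1)] assms(2-)
      computable_in_compose[OF assms(5)])

text \<open>The parameter m and the arbitrary oracle allow two uses: uniformly in m with the halting
  problem, and for a fixed bound without oracle. Assumption \<open>ex\<close> makes the search for a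
  block total.\<close>

lemma decidable_in_diag:
  assumes T: "clocks T F" and b: "computable_in A b" and D: "computable_in A (\<lambda>z. D (pfst z) (psnd z))"
    and ex: "\<And>m N. \<exists>t. good T (b m) N (D m N) t"
  shows "decidable_in A (\<lambda>z. diag T (b (pfst z)) (D (pfst z)) (psnd z))"
proof -
  have D': "computable_in A f \<Longrightarrow> computable_in A g \<Longrightarrow> computable_in A (\<lambda>x. D (f x) (g x))" for f g
    by (rule computable_in_compose2[OF D])
  have b': "computable_in A f \<Longrightarrow> computable_in A (\<lambda>x. b (f x))" for f
    by (rule computable_in_compose[OF b])
  have blk: "computable_in A (\<lambda>z. block T (b (pfst z)) (D (pfst z)) (psnd z))"
    unfolding block_def
    by (intro computable_in_arith computable_in_Least decidable_in_good[OF T] b' D' ex)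
  have "computable_in A (\<lambda>z. block_at T (b (pfst z)) (D (pfst z)) (psnd z))"
    unfolding block_at_def
    by (intro computable_in_arith
      computable_in_compose2[OF blk, where g = "\<lambda>x. 0"]
      computable_in_compose2[OF blk, where g = "\<lambda>x. Suc (pfst (psnd x))"])
  then show ?thesis
    unfolding diag_def Let_def
    by (intro computable_in_arith decidable_in_digit clocks_computable[OF T])
qed

section \<open>The maximal number of halting programs\<close>

lemma halted_le: "halted T B t \<le> B"
proof -
  have "halted T B t \<le> (\<Sum>i<B. 1)" unfolding halted_def by (rule sum_mono) auto
  then show ?thesis by simp
qed

lemma not_good_Suc_B: "\<not> good T B N (Suc B) t"
  using halted_le[of T B t] by (simp add: good_def)

lemma not_good_above_max: "\<not> good T B N (Suc (max_halting T B N)) t"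
proof -
  have "\<not> (\<exists>t. good T B N (Suc (max_halting T B N)) t)"
    unfolding max_halting_def by (rule LeastI[of _ B]) (simp add: not_good_Suc_B)
  then show ?thesis by blast
qed

lemma good_max_halting: "\<exists>t. good T B N (max_halting T B N) t"
proof (cases "max_halting T B N")
  case 0
  have "good T B N 0 (prod_encode (N + B, 0))" by (simp add: good_def)
  then show ?thesis using 0 by metis
next
  case (Suc d)
  then have "d < (LEAST d. \<not> (\<exists>t. good T B N (Suc d) t))" by (simp add: max_halting_def)
  from not_less_Least[OF this] show ?thesis by (simp add: Suc)
qed

text \<open>A later starting point only removes admissible inputs.\<close>

lemma max_halting_antimono: "antimono (max_halting T B)"
proof
  fix N N' :: nat assume "N \<le> N'"
  then have "\<not> (\<exists>t. good T B N' (Suc (max_halting T B N)) t)"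
    using not_good_above_max[of T B N] by (auto simp: good_def)
  then show "max_halting T B N' \<le> max_halting T B N"
    unfolding max_halting_def[of T B N'] by (rule Least_le)
qed

lemma antimono_nat_eventually_const:
  fixes g :: "nat \<Rightarrow> nat"
  assumes "antimono g"
  shows "\<exists>N. \<forall>n\<ge>N. g n = g N"
proof -
  obtain N where N: "\<And>n. g N \<le> g n"
    using ex_has_least_nat[of "\<lambda>_. True" _ g] by auto
  then have "\<forall>n\<ge>N. g n = g N" using antimonoD[OF assms] by (simp add: order_antisym)
  then show ?thesis by blast
qed

text \<open>The point of stabilization and the values before it are only known to exist, so this
  gives nothing uniform in B.\<close>

lemma computable_max_halting: "computable_in {} (max_halting T B)"
  using antimono_nat_eventually_const[OF max_halting_antimono, of T B]
    computable_in_eventually_const by metis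

text \<open>Whether d + 1 can be attained is an existential question, which the oracle answers
  uniformly in the bound, N and d. The search for the maximum ends at the bound at the
  latest.\<close>

lemma computable_in_halting_max_halting:
  assumes T: "clocks T F" and b: "computable_in {} b"
  shows "computable_in halting_problem (\<lambda>z. max_halting T (b (pfst z)) (psnd z))"
proof -
  have b': "computable_in {} f \<Longrightarrow> computable_in {} (\<lambda>x. b (f x))" for f
    by (rule computable_in_compose[OF b])
  have "decidable_in halting_problem
      (\<lambda>x. \<exists>t. good T (b (pfst (pfst x))) (psnd (pfst x)) (Suc (psnd x)) t)"
    by (intro decidable_in_halting_Ex decidable_in_good[OF T] computable_in_arith b')
  then show ?thesis
    unfolding max_halting_def using not_good_Suc_B
    by (intro computable_in_Least decidable_in_not) blast+
qed

text \<open>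
  A program that halts on \<open>n\<close> only after the clock has run out would, together with those that
  have halted in time, exceed the maximum.
\<close>
lemma halting_in_time:
  assumes T: "clocks T F" and good: "good T B N (max_halting T B N) t"
    and F: "F (prod_encode (i, pfst t)) = Some v" and "i < B"
  shows "T (prod_encode (i, pfst t)) (psnd t) = Suc v"
proof (rule ccontr)
  let ?n = "pfst t"
  assume neq: "T (prod_encode (i, ?n)) (psnd t) \<noteq> Suc v"
  have 0: "T (prod_encode (i, ?n)) (psnd t) = 0"
    using clocks_sound[OF T, of "prod_encode (i, ?n)" "psnd t"] F neq
    by (cases "T (prod_encode (i, ?n)) (psnd t)") auto
  have "\<forall>\<^sub>F s in sequentially. \<forall>j\<in>{..<B}. F (prod_encode (j, ?n)) \<noteq> None \<longrightarrow> T (prod_encode (j, ?n)) s \<noteq> 0"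
  proof (intro eventually_ball_finite ballI)
    fix j
    show "\<forall>\<^sub>F s in sequentially. F (prod_encode (j, ?n)) \<noteq> None \<longrightarrow> T (prod_encode (j, ?n)) s \<noteq> 0"
    proof (cases "F (prod_encode (j, ?n))")
      case (Some w)
      from clocks_complete[OF T this] show ?thesis by eventually_elim simp
    qed simp
  qed simp
  \<comment> \<open>A clock late enough for all programs below B that halt on \<open>?n\<close> at
    all.\<close>
  then obtain s where s: "\<And>j. j < B \<Longrightarrow> F (prod_encode (j, ?n)) \<noteq> None \<Longrightarrow> T (prod_encode (j, ?n)) s \<noteq> 0"
    by (auto dest!: eventually_happens)
  have "halted T B t < halted T B (prod_encode (?n, s))"
    unfolding halted_def
  proof (rule sum_strict_mono_ex1)
    show "\<forall>j\<in>{..<B}. (of_bool (T (prod_encode (j, ?n)) (psnd t) \<noteq> 0) :: nat)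
      \<le> of_bool (T (prod_encode (j, pfst (prod_encode (?n, s)))) (psnd (prod_encode (?n, s))) \<noteq> 0)"
    proof
      fix j assume "j \<in> {..<B}"
      moreover have "F (prod_encode (j, ?n)) \<noteq> None" if "T (prod_encode (j, ?n)) (psnd t) \<noteq> 0"
        using that clocks_sound[OF T, of "prod_encode (j, ?n)" "psnd t"]
        by (cases "T (prod_encode (j, ?n)) (psnd t)") auto
      ultimately show "(of_bool (T (prod_encode (j, ?n)) (psnd t) \<noteq> 0) :: nat)
        \<le> of_bool (T (prod_encode (j, pfst (prod_encode (?n, s)))) (psnd (prod_encode (?n, s))) \<noteq> 0)"
        using s[of j] by auto
    qed
    show "\<exists>j\<in>{..<B}. (of_bool (T (prod_encode (j, ?n)) (psnd t) \<noteq> 0) :: nat)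
      < of_bool (T (prod_encode (j, pfst (prod_encode (?n, s)))) (psnd (prod_encode (?n, s))) \<noteq> 0)"
      using s[of i] \<open>i < B\<close> F 0 by (intro bexI[of _ i]) auto
  qed simp
  \<comment> \<open>The input is unchanged, so the margin of B positions after N persists.\<close>
  then have "good T B N (Suc (max_halting T B N)) (prod_encode (?n, s))"
    using good by (simp add: good_def)
  then show False using not_good_above_max by blast
qed

text \<open>The equation \<open>block_at T B D N = block T B D N\<close> expresses that a block
  starts at N.\<close>

lemma block_at_within:
  assumes "block_at T B D N = block T B D N" "N \<le> x" "x < pfst (psnd (block T B D N))"
  shows "block_at T B D x = block T B D N"
  using assms(2,3)
proof (induction x rule: dec_induct)
  case base show ?case by (rule assms(1))
next
  case (step x)
  then show ?case by (simp add: block_at_def)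
qed

lemma block_at_next:
  assumes start: "block_at T B D N = block T B D N" and "N < pfst (psnd (block T B D N))"
  shows "block_at T B D (pfst (psnd (block T B D N))) = block T B D (pfst (psnd (block T B D N)))"
proof -
  obtain x where x: "pfst (psnd (block T B D N)) = Suc x"
    using assms(2) by (cases "pfst (psnd (block T B D N))") auto
  have "block_at T B D x = block T B D N"
    using assms x by (intro block_at_within[OF start]) auto
  then show ?thesis by (simp add: x block_at_def)
qed

lemma diag_escapes:
  assumes T: "clocks T F" and "0 < B"
  shows "\<exists>n\<ge>M. \<forall>i<B. F (prod_encode (i, n)) \<noteq> Some (str_code (seq_prefix (diag T B (max_halting T B)) n))"
proof -
  define D where "D = max_halting T B"
  define next_n where "next_n N = pfst (psnd (block T B D N))" for N
  have good: "good T B N (D N) (psnd (block T B D N))" for N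
    using good_max_halting[of T B N] unfolding block_def D_def by (auto intro: LeastI_ex)
  then have ge: "N + B \<le> next_n N" for N by (simp add: good_def next_n_def)
  \<comment> \<open>Every block has length at least B > 0, so blocks start arbitrarily late.\<close>
  have "\<exists>N\<ge>M. block_at T B D N = block T B D N"
  proof (induction M)
    case 0
    show ?case by (auto simp: block_at_def intro: exI[of _ 0])
  next
    case (Suc M)
    then obtain N where N: "N \<ge> M" "block_at T B D N = block T B D N" by blast
    show ?case
      using block_at_next[OF N(2)] ge[of N] N(1) \<open>0 < B\<close>
      by (intro exI[of _ "next_n N"]) (auto simp: next_n_def)
  qed
  then obtain N where N: "N \<ge> M" "block_at T B D N = block T B D N" by blast
  define t where "t = psnd (block T B D N)"
  have n: "next_n N = pfst t" by (simp add: t_def next_n_def)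
  have "F (prod_encode (i, pfst t)) \<noteq> Some (str_code (seq_prefix (diag T B D) (pfst t)))" if "i < B" for i
  proof
    let ?v = "str_code (seq_prefix (diag T B D) (pfst t))"
    assume F: "F (prod_encode (i, pfst t)) = Some ?v"
    have lt: "N + i < pfst t" using ge[of N] \<open>i < B\<close> by (simp add: n)
    have "T (prod_encode (i, pfst t)) (psnd t) = Suc ?v"
      using halting_in_time[OF T _ F \<open>i < B\<close>] good[of N] by (simp add: t_def D_def)
    moreover have "block_at T B D (N + i) = prod_encode (N, t)"
      using block_at_within[OF N(2), of "N + i"] lt by (simp add: t_def) (simp add: block_def)
    ultimately have "diag T B D (N + i) \<longleftrightarrow> \<not> digit ?v (N + i)"
      by (simp add: diag_def)
    \<comment> \<open>By assumption the output is the prefix itself, so its digit is the very bit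
      that was chosen to differ from it.\<close>
    moreover have "digit ?v (N + i) \<longleftrightarrow> diag T B D (N + i)"
      using lt by (subst digit_str_code) (simp_all add: seq_prefix_def)
    ultimately show False by blast
  qed
  moreover have "M \<le> pfst t" using ge[of N] N(1) by (simp add: n)
  ultimately show ?thesis unfolding D_def by blast
qed

section \<open>Computability of the diagonal sequence, with and without the oracle\<close>

lemma computable_seq_diag:
  assumes "clocks T F"
  shows "computable_seq (diag T B (max_halting T B))"
proof -
  have "decidable_in {} (\<lambda>z. diag T B (max_halting T B) (psnd z))"
    \<comment> \<open>With a constant parameter the nonuniform \<open>computable_max_halting\<close>
      suffices.\<close>
    by (rule decidable_in_diag[OF assms, where b = "\<lambda>m. B" and D = "\<lambda>m. max_halting T B"])
      (intro computable_in_basic computable_in_compose[OF computable_max_halting] good_max_halting)+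
  from computable_in_compose2[OF this computable_in_const computable_in_id]
  show ?thesis by (simp add: computable_seq_def computable_in_empty)
qed

text \<open>Uniformity in the bound combines all diagonal sequences into a single language with
  oracle, to which optimality can be applied.\<close>

lemma prog_lang_diag:
  assumes T: "clocks T F" and b: "computable_in {} b"
  shows "prog_lang halting_problem
    (\<lambda>p n. Some (seq_prefix (diag T (b (str_code p)) (max_halting T (b (str_code p)))) n))"
proof -
  have "decidable_in halting_problem
      (\<lambda>z. diag T (b (pfst z)) (max_halting T (b (pfst z))) (psnd z))"
    using computable_in_halting_max_halting[OF T b] good_max_halting
    by (intro decidable_in_diag[OF T computable_in_mono[OF b]]) auto
  note diag = computable_in_compose2[OF this]
  have "computable_in halting_problem (\<lambda>z.
      str_code (seq_prefix (diag T (b (pfst z)) (max_halting T (b (pfst z)))) (psnd z)))"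
    unfolding str_code_seq_prefix
    by (intro computable_in_sum computable_in_arith diag)
  then show ?thesis
    unfolding prog_lang_def computable_in_def by (metis fst_conv option.simps(9) prod_encode_inverse snd_conv)
qed

section \<open>Lower bound for the limsup and the choice of parameters\<close>

lemma M_infinity_geI:
  assumes "\<And>M. \<exists>n\<ge>M. \<forall>p. length p < k \<longrightarrow> U p n \<noteq> Some (seq_prefix \<alpha> n)"
  shows "enat k \<le> M_infinity U \<alpha>"
proof -
  have "enat k \<le> (SUP n\<in>{M..}. cond_complexity U (seq_prefix \<alpha> n) n)" for M
  proof -
    obtain n where n: "n \<ge> M" "\<forall>p. length p < k \<longrightarrow> U p n \<noteq> Some (seq_prefix \<alpha> n)"
      using assms by blast
    have "enat k \<le> cond_complexity U (seq_prefix \<alpha> n) n"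
      unfolding cond_complexity_def using n(2) by (intro INF_greatest) (auto simp: not_less[symmetric])
    with n(1) show ?thesis by (intro SUP_upper2[of n]) auto
  qed
  then show ?thesis unfolding M_infinity_def limsup_INF_SUP by (intro INF_greatest)
qed

theorem theorem4:
  fixes U U0 :: "bool list \<Rightarrow> nat \<Rightarrow> bool list option"
    and f :: "nat \<Rightarrow> nat"
  assumes "optimal {} U"
    and "optimal halting_problem U0"
    and "computable f"
  shows "\<exists>c::nat. \<forall>m::nat. \<exists>\<alpha>. computable_seq \<alpha> \<and>
           seq_complexity U0 \<alpha> \<le> enat (m + c) \<and> M_infinity U \<alpha> \<ge> enat (f m)"
proof -
  obtain e where e: "\<And>p n. eval {} e (prod_encode (str_code p, n)) = map_option str_code (U p n)"
    using assms(1) unfolding optimal_def prog_lang_def by blast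
  obtain T where T: "clocks T (eval {} e)" using clocks_exists by blast
  \<comment> \<open>\<open>m\<close> is given by a program of length \<open>m\<close> with code \<open>v \<ge> m\<close>; the sum over all \<open>i \<le> v\<close>
    avoids recovering \<open>m\<close> from \<open>v\<close>.\<close>
  define b :: "nat \<Rightarrow> nat" where "b v = 2 ^ (\<Sum>i<Suc v. f i)" for v
  define \<alpha> where "\<alpha> p = diag T (b (str_code p)) (max_halting T (b (str_code p)))" for p
  have f: "computable_in {} f" using assms(3) by (simp add: computable_in_empty)
  have "computable_in {} b"
    unfolding b_def
    by (intro computable_in_sum computable_in_arith computable_in_compose[OF f])
  then have "prog_lang halting_problem (\<lambda>p n. Some (seq_prefix (\<alpha> p) n))"
    unfolding \<alpha>_def by (rule prog_lang_diag[OF T])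
  \<comment> \<open>The constant is fixed here, before m is chosen.\<close>
  then obtain c where c: "\<And>p. \<exists>q. length q \<le> length p + c \<and> U0 q = (\<lambda>n. Some (seq_prefix (\<alpha> p) n))"
    using assms(2) unfolding optimal_def by blast
  show ?thesis
  proof (intro exI[of _ c] allI)
    fix m
    let ?p = "replicate m False"
    let ?B = "b (str_code ?p)"
    obtain q where q: "length q \<le> m + c" "U0 q = (\<lambda>n. Some (seq_prefix (\<alpha> ?p) n))"
      using c[of ?p] by auto
    have "seq_complexity U0 (\<alpha> ?p) \<le> enat (length q)"
      unfolding seq_complexity_def using q(2) by (intro INF_lower) simp
    also have "\<dots> \<le> enat (m + c)" using q(1) by simp
    finally have "seq_complexity U0 (\<alpha> ?p) \<le> enat (m + c)" .
    moreover have "enat (f m) \<le> M_infinity U (\<alpha> ?p)"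
    proof (rule M_infinity_geI)
      fix M
      have "0 < ?B" by (simp add: b_def)
      from diag_escapes[OF T this, of M] obtain n where n: "n \<ge> M"
        "\<And>i. i < ?B \<Longrightarrow> eval {} e (prod_encode (i, n)) \<noteq> Some (str_code (seq_prefix (\<alpha> ?p) n))"
        unfolding \<alpha>_def by blast
      \<comment> \<open>The code of m false bits is 2^m - 1, which is at least m; so
        \<open>f m\<close> occurs in the sum defining \<open>?B\<close>.\<close>
      have "m < Suc (str_code ?p)" unfolding str_code_replicate by (rule less_exp)
      then have "f m \<le> (\<Sum>i<Suc (str_code ?p). f i)" by (intro member_le_sum) auto
      then have B: "2 ^ f m \<le> ?B" unfolding b_def by (intro power_increasing) auto
      have "U p n \<noteq> Some (seq_prefix (\<alpha> ?p) n)" if "length p < f m" for p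
      proof -
        \<comment> \<open>All programs shorter than \<open>f m\<close> have codes below
          \<open>?B\<close>, so the diagonalization covers them.\<close>
        have "str_code p < 2 ^ Suc (length p)" using str_code_less[of p] by linarith
        also have "\<dots> \<le> 2 ^ f m" using that by (intro power_increasing) auto
        finally have "str_code p < ?B" using B by linarith
        from n(2)[OF this] show ?thesis unfolding e by auto
      qed
      with n(1) show "\<exists>n\<ge>M. \<forall>p. length p < f m \<longrightarrow> U p n \<noteq> Some (seq_prefix (\<alpha> ?p) n)" by blast
    qed
    moreover have "computable_seq (\<alpha> ?p)" unfolding \<alpha>_def by (rule computable_seq_diag[OF T])
    ultimately show "\<exists>\<alpha>. computable_seq \<alpha> \<and> seq_complexity U0 \<alpha> \<le> enat (m + c) \<and>
      M_infinity U \<alpha> \<ge> enat (f m)" by blast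
  qed
qed

end
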